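(* Let $\psi_1,\psi_2$ be closed LTL$_F$ specifications and $M\in\mathbb{N}$ with $M\le N$, where $N$ is the length of the trajectories of the LTL$_F$ specifications $\psi_1,\psi_2$. Let $\psi$ be constructed with the grammar $$\psi:=\psi_1\mid\psi_1\wedge\psi_2\mid\psi_1\vee\psi_2\mid\bigcirc\psi_1\mid\bigcirc^M\psi_1\mid\square\psi_1\mid\square^M\psi_1\mid\lozenge\psi_1\mid\lozenge^M\psi_1.$$ Then the specification $\psi$ is a closed specification.
   Context: Let $X\subseteq\mathbb{R}^n$ be the state space, $\mathsf{AP}$ a finite set of atomic propositions and $L:X\to 2^{\mathsf{AP}}$ a measurable labeling function. LTL$_F$ formulas over $\mathsf{AP}$ are built inductively as $\psi::=\mathsf{true}\mid p\mid\neg\psi\mid\psi_1\wedge\psi_2\mid\psi_1\vee\psi_2\mid\bigcirc\psi\mid\psi_1\,\mathsf{U}\,\psi_2\mid\square\psi\mid\lozenge\psi$ with $p\in\mathsf{AP}$. For a finite word $\omega=(\omega_0,\dots,\omega_{N-1})$ of length $N$ with letters in $2^{\mathsf{AP}}$, satisfaction at step $i<N$ is defined by: $\omega_i\vDash\mathsf{true}$ always holds; $\omega_i\vDash p$ if $p\in\omega_i$; $\omega_i\vDash\neg\psi$ if $\omega_i\nvDash\psi$; $\wedge$ and $\vee$ are interpreted as "and" and "or"; $\omega_i\vDash\bigcirc\psi$ if $\omega_{i+1}\vDash\psi$; $\omega_i\vDash\psi_1\,\mathsf{U}\,\psi_2$ if for some $m$ with $i\le m<N$ we have $\omega_m\vDash\psi_2$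 and $\omega_k\vDash\psi_1$ for all $i\le k<m$; $\omega_i\vDash\square\psi$ if $\omega_m\vDash\psi$ for all $i\le m<N$; $\omega_i\vDash\lozenge\psi$ if $\omega_m\vDash\psi$ for some $i\le m<N$. The bounded operators are defined for $0\le j<N-i$ by: $\omega_i\vDash\bigcirc^j\psi$ if $\omega_{i+j}\vDash\psi$; $\omega_i\vDash\square^j\psi$ if $\omega_m\vDash\psi$ for all $i\le m\le i+j$; $\omega_i\vDash\lozenge^j\psi$ if $\omega_m\vDash\psi$ for some $i\le m<i+j$. One writes $\omega\vDash\psi$ iff $\omega_0\vDash\psi$. A trajectory $w=(x_0,\dots,x_{N-1})\in X^N$ satisfies $\psi$ iff the word $(L(x_0),\dots,L(x_{N-1}))$ does. The limit of a sequence of trajectories $w_i=(x_{0,i},x_{1,i},\dots)$, $i\in\mathbb{N}$, is the element-wise limit $w=(x_0,x_1,\dots)$ with $x_j=\lim_{i\to\infty}x_{j,i}$ for all $j$; the sequence is converging whenever this limit exists. An LTL$_F$ formula $\psi$ is closed if for any converging sequence of trajectories $(w_i)_{i\in\mathbb{N}}$ with $w_i\vDash\psi$ for all $i\in\mathbb{N}$, the limit satisfies $\lim_{i\to\infty}w_i\vDash\psi$. *)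

theory Defs
  imports "HOL-Analysis.Analysis"
begin

datatype 'ap ltlf =
    TrueF
  | Atom 'ap
  | Neg "'ap ltlf"
  | And "'ap ltlf" "'ap ltlf"
  | Or "'ap ltlf" "'ap ltlf"
  | Next "'ap ltlf"
  | Until "'ap ltlf" "'ap ltlf"
  | Always "'ap ltlf"
  | Eventually "'ap ltlf"
  | NextN nat "'ap ltlf"
  | AlwaysN nat "'ap ltlf"
  | EventuallyN nat "'ap ltlf"

text \<open>Satisfaction at step \<open>i\<close>, meaningful for \<open>i < length w\<close> only. A reference to a step beyond
  the end of the word counts as not satisfied (strong next), so \<open>NextN j\<close> and
  \<open>AlwaysN j\<close> fail at \<open>i\<close> if \<open>i + j \<ge> length w\<close>. The window of \<open>AlwaysN j\<close> includes
  \<open>i + j\<close>, whereas that of \<open>EventuallyN j\<close> excludes it.\<close>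

primrec sat_at :: "'ap set list \<Rightarrow> nat \<Rightarrow> 'ap ltlf \<Rightarrow> bool" where
  "sat_at w i TrueF \<longleftrightarrow> True"
| "sat_at w i (Atom p) \<longleftrightarrow> p \<in> w ! i"
| "sat_at w i (Neg f) \<longleftrightarrow> \<not> sat_at w i f"
| "sat_at w i (And f g) \<longleftrightarrow> sat_at w i f \<and> sat_at w i g"
| "sat_at w i (Or f g) \<longleftrightarrow> sat_at w i f \<or> sat_at w i g"
| "sat_at w i (Next f) \<longleftrightarrow> i + 1 < length w \<and> sat_at w (i + 1) f"
| "sat_at w i (Until f g) \<longleftrightarrow>
     (\<exists>m. i \<le> m \<and> m < length w \<and> sat_at w m g \<and> (\<forall>k. i \<le> k \<and> k < m \<longrightarrow> sat_at w k f))"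
| "sat_at w i (Always f) \<longleftrightarrow> (\<forall>m. i \<le> m \<and> m < length w \<longrightarrow> sat_at w m f)"
| "sat_at w i (Eventually f) \<longleftrightarrow> (\<exists>m. i \<le> m \<and> m < length w \<and> sat_at w m f)"
| "sat_at w i (NextN j f) \<longleftrightarrow> i + j < length w \<and> sat_at w (i + j) f"
| "sat_at w i (AlwaysN j f) \<longleftrightarrow>
     (\<forall>m. i \<le> m \<and> m \<le> i + j \<longrightarrow> m < length w \<and> sat_at w m f)"
| "sat_at w i (EventuallyN j f) \<longleftrightarrow>
     (\<exists>m. i \<le> m \<and> m < i + j \<and> m < length w \<and> sat_at w m f)"

definition traj_sat :: "('x \<Rightarrow> 'ap set) \<Rightarrow> 'x list \<Rightarrow> 'ap ltlf \<Rightarrow> bool" where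
  "traj_sat L x f \<longleftrightarrow> sat_at (map L x) 0 f"

definition trajectories :: "'x set \<Rightarrow> nat \<Rightarrow> 'x list set" where
  "trajectories X n = {x. length x = n \<and> set x \<subseteq> X}"

definition traj_limit :: "nat \<Rightarrow> (nat \<Rightarrow> 'x::topological_space list) \<Rightarrow> 'x list \<Rightarrow> bool" where
  "traj_limit n x y \<longleftrightarrow> (\<forall>j<n. (\<lambda>i. x i ! j) \<longlonglongrightarrow> y ! j)"

text \<open>Closedness for trajectory length \<open>N\<close>. Evaluating a subformula at step \<open>i\<close> of a trajectory
  of length \<open>N\<close> amounts to evaluating it on the remaining \<open>N - i\<close> states, so every nonempty
  trajectory of length at most \<open>N\<close> is taken into account. Length \<open>N\<close> alone would not do: for \<open>N = 2\<close>
  the formula \<open>Or (Next TrueF) (Atom p)\<close> always holds on trajectories of length 2, but \<open>Next\<close> of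
  it says that \<open>p\<close> holds at step 1, which need not be preserved in the limit. Closedness without a
  length bound is closedness for all \<open>N\<close>. The limit is itself required to be a trajectory in \<open>X\<close>.\<close>

definition closed_spec ::
  "'x::topological_space set \<Rightarrow> ('x \<Rightarrow> 'ap set) \<Rightarrow> nat \<Rightarrow> 'ap ltlf \<Rightarrow> bool" where
  "closed_spec X L N f \<longleftrightarrow>
     (\<forall>n x y. 0 < n \<and> n \<le> N \<and> (\<forall>i. x i \<in> trajectories X n) \<and> y \<in> trajectories X n \<and>
        traj_limit n x y \<and> (\<forall>i. traj_sat L (x i) f) \<longrightarrow> traj_sat L y f)"

inductive closed_grammar :: "nat \<Rightarrow> 'ap ltlf \<Rightarrow> 'ap ltlf \<Rightarrow> 'ap ltlf \<Rightarrow> bool"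
  for M :: nat and f1 f2 :: "'ap ltlf" where
  "closed_grammar M f1 f2 f1"
| "closed_grammar M f1 f2 (And f1 f2)"
| "closed_grammar M f1 f2 (Or f1 f2)"
| "closed_grammar M f1 f2 (Next f1)"
| "closed_grammar M f1 f2 (NextN M f1)"
| "closed_grammar M f1 f2 (Always f1)"
| "closed_grammar M f1 f2 (AlwaysN M f1)"
| "closed_grammar M f1 f2 (Eventually f1)"
| "closed_grammar M f1 f2 (EventuallyN M f1)"

end

theory Submission
  imports Defs
begin

text \<open>A formula holds at step \<open>j\<close> of a word iff it holds at the start of the \<open>j\<close>-th suffix, and suffixes
  of converging trajectories converge. A closed formula is therefore preserved in the limit at
  every step, and, passing to a subsequence, it suffices that it holds infinitely often. The
  latter makes disjunctions over finitely many formulas or steps harmless: by the pigeonhole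
  principle one disjunct holds infinitely often.\<close>

text \<open>Every operator looks only forward from the current step, and the end of the word moves
  along with the suffix, so induction on \<open>f\<close> needs only a reindexing of the quantified
  steps.\<close>

lemma sat_at_drop:
  assumes "j \<le> length w"
  shows "sat_at (drop j w) i f \<longleftrightarrow> sat_at w (j + i) f"
proof -
  \<comment> \<open>These two facts substitute \<open>j + m\<close> for \<open>m\<close> in the step
    quantifiers of the temporal operators.\<close>
  have ex_shift: "(\<exists>m\<ge>j + i. P m) \<longleftrightarrow> (\<exists>m\<ge>i. P (j + m))" for i and P :: "nat \<Rightarrow> bool"
    by (auto simp: le_iff_add add.assoc)
  have all_shift: "(\<forall>m\<ge>j + i. P m) \<longleftrightarrow> (\<forall>m\<ge>i. P (j + m))" for i and P :: "nat \<Rightarrow> bool"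
    using ex_shift[of i "\<lambda>m. \<not> P m"] by blast
  have less_drop: "m < length (drop j w) \<longleftrightarrow> j + m < length w" for m
    using assms by auto
  show ?thesis
  proof (induction f arbitrary: i)
    case (Until f g)
    have "(\<forall>k. i \<le> k \<and> k < m \<longrightarrow> sat_at w (j + k) f) \<longleftrightarrow>
        (\<forall>k. j + i \<le> k \<and> k < j + m \<longrightarrow> sat_at w k f)" for m
      using all_shift[of i "\<lambda>k. k < j + m \<longrightarrow> sat_at w k f"] by auto
    then show ?case
      using ex_shift[of i "\<lambda>m. m < length w \<and> sat_at w m g \<and> (\<forall>k. j + i \<le> k \<and> k < m \<longrightarrow> sat_at w k f)"]
      by (simp only: sat_at.simps less_drop Until.IH)
  next
    case (Always f)
    then show ?case
      using all_shift[of i "\<lambda>m. m < length w \<longrightarrow> sat_at w m f"]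
      by (simp only: sat_at.simps less_drop) blast
  next
    case (Eventually f)
    then show ?case
      using ex_shift[of i "\<lambda>m. m < length w \<and> sat_at w m f"]
      by (simp only: sat_at.simps less_drop)
  next
    case (AlwaysN k f)
    then show ?case
      using all_shift[of i "\<lambda>m. m \<le> j + i + k \<longrightarrow> m < length w \<and> sat_at w m f"]
      by (simp only: sat_at.simps less_drop add.assoc add_le_cancel_left) blast
  next
    case (EventuallyN k f)
    then show ?case
      using ex_shift[of i "\<lambda>m. m < j + i + k \<and> m < length w \<and> sat_at w m f"]
      by (simp only: sat_at.simps less_drop add.assoc add_less_cancel_left)
  \<comment> \<open>The remaining cases quantify over no steps. For atoms, \<open>nth_drop\<close>
    requires only \<open>j \<le> length w\<close>, so \<open>i\<close> may even lie beyond the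
    end.\<close>
  qed (use assms in \<open>simp_all only: sat_at.simps less_drop nth_drop add.assoc\<close>)
qed

text \<open>Closedness is applied to the suffixes from step \<open>j\<close>, along a subsequence on
  which \<open>f\<close> always holds there. These have length \<open>n - j\<close>, which is why
  closedness has to cover lengths below \<open>N\<close>.\<close>

lemma closed_spec_frequently:
  fixes x :: "nat \<Rightarrow> 'x::topological_space list"
  assumes closed: "closed_spec X L N f"
    and "j < n" "n \<le> N"
    and x: "\<And>i. x i \<in> trajectories X n" and y: "y \<in> trajectories X n"
    and lim: "traj_limit n x y"
    and freq: "\<exists>\<^sub>F i in sequentially. sat_at (map L (x i)) j f"
  shows "sat_at (map L y) j f"
proof -
  \<comment> \<open>Frequently along \<open>sequentially\<close> means for infinitely many
    \<open>i\<close>; enumerating these in increasing order yields the subsequence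
    \<open>r\<close>.\<close>
  have "infinite {i. sat_at (map L (x i)) j f}"
    using freq unfolding cofinite_eq_sequentially[symmetric] frequently_cofinite .
  then obtain r :: "nat \<Rightarrow> nat" where r: "strict_mono r" "\<And>i. sat_at (map L (x (r i))) j f"
    using infinite_enumerate[of "{i. sat_at (map L (x i)) j f}"] by auto
  have len: "length (x i) = n" "length y = n" for i
    using x y by (auto simp: trajectories_def)
  have drop_sat: "traj_sat L (drop j v) f \<longleftrightarrow> sat_at (map L v) j f" if "length v = n" for v
    using sat_at_drop[of j "map L v" 0 f] that \<open>j < n\<close> by (simp add: traj_sat_def drop_map)
  have drop_traj: "drop j v \<in> trajectories X (n - j)" if "v \<in> trajectories X n" for v
    using that set_drop_subset[of j v] by (auto simp: trajectories_def)
  have "(\<lambda>i. x (r i) ! k) \<longlonglongrightarrow> y ! k" if "k < n" for k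
    using LIMSEQ_subseq_LIMSEQ[of "\<lambda>i. x i ! k", OF _ r(1)] lim that
    by (simp add: traj_limit_def o_def)
  then have "traj_limit (n - j) (\<lambda>i. drop j (x (r i))) (drop j y)"
    using len \<open>j < n\<close> by (simp add: traj_limit_def)
  moreover have "0 < n - j" "n - j \<le> N"
    using \<open>j < n\<close> \<open>n \<le> N\<close> by auto
  moreover have "\<forall>i. traj_sat L (drop j (x (r i))) f"
    using drop_sat len(1) r(2) by simp
  moreover have "\<forall>i. drop j (x (r i)) \<in> trajectories X (n - j)" "drop j y \<in> trajectories X (n - j)"
    using drop_traj x y by simp_all
  ultimately have "traj_sat L (drop j y) f"
    using closed[unfolded closed_spec_def, rule_format, of "n - j" "\<lambda>i. drop j (x (r i))" "drop j y"]
    by simp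
  then show ?thesis
    using drop_sat[OF len(2)] by blast
qed

theorem proposition7p5:
  fixes X :: "(real ^ 'n) set"
    and L :: "real ^ 'n \<Rightarrow> 'ap::finite set"
    and \<psi>\<^sub>1 \<psi>\<^sub>2 \<psi> :: "'ap ltlf"
    and M N :: nat
  assumes "L \<in> measurable (restrict_space borel X) (count_space UNIV)"
    and "closed_spec X L N \<psi>\<^sub>1"
    and "closed_spec X L N \<psi>\<^sub>2"
    and "M \<le> N"
    and "closed_grammar M \<psi>\<^sub>1 \<psi>\<^sub>2 \<psi>"
  shows "closed_spec X L N \<psi>"
  unfolding closed_spec_def
proof (intro allI impI, elim conjE)
  fix n x y
  assume n: "0 < n" "n \<le> N" and x: "\<forall>i. x i \<in> trajectories X n" and y: "y \<in> trajectories X n"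
    and lim: "traj_limit n x y" and sat: "\<forall>i. traj_sat L (x i) \<psi>"
  have len: "length (x i) = n" "length y = n" for i
    using x y by (auto simp: trajectories_def)
  have freq: "sat_at (map L y) j f"
    if "\<exists>\<^sub>F i in sequentially. sat_at (map L (x i)) j f" "j < n" "f \<in> {\<psi>\<^sub>1, \<psi>\<^sub>2}" for j f
    using closed_spec_frequently[of X L N f j n x y] that assms(2,3) n x y lim by blast
  have all: "sat_at (map L y) j f"
    if "\<And>i. sat_at (map L (x i)) j f" "j < n" "f \<in> {\<psi>\<^sub>1, \<psi>\<^sub>2}" for j f
    by (rule freq) (use that in simp_all)
  \<comment> \<open>The witness may vary with \<open>i\<close>, but \<open>J\<close> is finite, so a
    single step of \<open>J\<close> serves infinitely many \<open>i\<close>.\<close>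
  have ex: "\<exists>j\<in>J. sat_at (map L y) j f"
    if "\<And>i. \<exists>j\<in>J. sat_at (map L (x i)) j f" "J \<subseteq> {..<n}" "f \<in> {\<psi>\<^sub>1, \<psi>\<^sub>2}" for J f
  proof -
    have "finite J"
      using that(2) finite_subset by blast
    moreover have "\<exists>\<^sub>F i in sequentially. \<exists>j\<in>J. sat_at (map L (x i)) j f"
      using that(1) by simp
    ultimately obtain j where "j \<in> J" "\<exists>\<^sub>F i in sequentially. sat_at (map L (x i)) j f"
      by (auto simp: frequently_bex_finite_distrib)
    then show ?thesis
      using freq that(2,3) by blast
  qed
  from assms(5) sat show "traj_sat L y \<psi>"
  proof cases
    \<comment> \<open>Which disjunct holds may depend on \<open>i\<close>; one of them holds
      infinitely often.\<close>
    case 3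
    then have "\<exists>\<^sub>F i in sequentially. sat_at (map L (x i)) 0 \<psi>\<^sub>1 \<or> sat_at (map L (x i)) 0 \<psi>\<^sub>2"
      using sat by (simp add: traj_sat_def)
    then show ?thesis
      using 3 freq n(1) by (auto simp: traj_sat_def frequently_disj_iff)
  next
    case 8
    then show ?thesis
      using sat len ex[of "{..<n}" \<psi>\<^sub>1] by (auto simp: traj_sat_def Bex_def)
  next
    \<comment> \<open>The window stops before step \<open>M\<close> and is cut off at the end of the
      trajectory, since \<open>n\<close> may be smaller than \<open>M\<close>; hence
      \<open>min n M\<close>.\<close>
    case 9
    then show ?thesis
      using sat len ex[of "{..<min n M}" \<psi>\<^sub>1] by (simp add: traj_sat_def Bex_def conj_ac)
  \<comment> \<open>In the other cases the steps concerned do not depend on \<open>i\<close>, so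
    \<open>all\<close> applies to each of them. Range conditions depend only on the common length
    \<open>n\<close> and carry over to \<open>y\<close>.\<close>
  qed (use sat len all n(1) in \<open>auto simp: traj_sat_def\<close>)
qed

end
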